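(* Let $q$ be a prime power, $V=\mathbb{F}_q^2$, and let $m>0$ be an integer. Then - $\beta_{\rm sep}(\mathbb{F}_q[V^m]^{\mathrm{O}_2^{+}(\mathbb{F}_q)})=2$, in case $q=2$; - $\beta_{\rm sep}(\mathbb{F}_q[V^m]^{\mathrm{O}_2^{+}(\mathbb{F}_q)})=q-1$, in case $q>2$.
   Context: For $\alpha\in\mathbb{F}_q^\times$ put $\sigma_\alpha=\begin{pmatrix}0&\alpha\\ \alpha^{-1}&0\end{pmatrix}$, $\tau_\alpha=\begin{pmatrix}\alpha&0\\0&\alpha^{-1}\end{pmatrix}$; then $\mathrm{O}_2^{+}(\mathbb{F}_q)=\{\sigma_\alpha,\tau_\alpha\mid\alpha\in\mathbb{F}_q^\times\}$, a subgroup of $\mathrm{GL}_2(\mathbb{F}_q)$. It acts diagonally on $V^m$: $g\cdot(v_1,\ldots,v_m)=(gv_1,\ldots,gv_m)$. The coordinate ring of $V^m$ is the polynomial ring $\mathbb{F}_q[V^m]=\mathbb{F}_q[x_1,\ldots,x_m,y_1,\ldots,y_m]$, where $x_i(\underline v)$ and $y_i(\underline v)$ are the first and second coordinates of $v_i$ for $\underline v=(v_1,\ldots,v_m)\in V^m$. The group acts on $\mathbb{F}_q[V^m]$ by algebra automorphisms extending $(g\cdot f)(\underline v)=f(g^{-1}\cdot\underline v)$ on linear forms, i.e. $\sigma_1\cdot x_i=y_i$, $\sigma_1\cdot y_i=x_i$, $\tau_\alpha\cdot x_i=\alpha^{-1}x_i$, $\tau_\alpha\cdot y_i=\alpha y_i$;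 and $\mathbb{F}_q[V^m]^{\mathrm{O}_2^{+}(\mathbb{F}_q)}$ is the algebra of polynomials fixed by the group. Elements $u,v\in V^m$ are separated by a set $S$ of invariant polynomials if there is $f\in S$ with $f(u)\ne f(v)$. A subset $S$ of the invariant algebra is separating if any $u,v\in V^m$ that are separated by the whole invariant algebra are separated by $S$. $\beta_{\rm sep}(\mathbb{F}_q[V^m]^{\mathrm{O}_2^{+}(\mathbb{F}_q)})$ denotes the minimal integer $\beta_{\rm sep}$ such that the set of all invariant polynomials of degree less than or equal to $\beta_{\rm sep}$ is separating. *)

theory Defs
  imports "HOL-Analysis.Analysis" "HOL-Library.Poly_Mapping"
begin

text \<open>
  With \<open>V = 'a^'n\<close> and the index type \<open>'m\<close> having \<open>m\<close> elements, \<open>V\<^sup>m\<close> is the type \<open>'a^'n^'m\<close>.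
  Its coordinate ring consists of the formal polynomials (not the polynomial functions, which is
  a real distinction over a finite field) in variables indexed by \<open>'m \<times> 'n\<close>; the variable \<open>(i, j)\<close>
  stands for the \<open>j\<close>-th coordinate of \<open>v\<^sub>i\<close>. For \<open>'n = 2\<close>, \<open>(i, 1)\<close> is \<open>x\<^sub>i\<close> and \<open>(i, 2)\<close> is \<open>y\<^sub>i\<close>.
\<close>

type_synonym ('m, 'n, 'a) coord_ring = "(('m \<times> 'n) \<Rightarrow>\<^sub>0 nat) \<Rightarrow>\<^sub>0 'a"

definition Const :: "'a \<Rightarrow> ('v \<Rightarrow>\<^sub>0 nat) \<Rightarrow>\<^sub>0 'a::zero" where
  "Const c = Poly_Mapping.single 0 c"

definition Var :: "'v \<Rightarrow> ('v \<Rightarrow>\<^sub>0 nat) \<Rightarrow>\<^sub>0 'a::zero_neq_one" where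
  "Var v = Poly_Mapping.single (Poly_Mapping.single v 1) 1"

definition total_degree :: "(('v \<Rightarrow>\<^sub>0 nat) \<Rightarrow>\<^sub>0 'a::zero) \<Rightarrow> nat" where
  \<comment> \<open>The zero polynomial gets degree \<open>0\<close>.\<close>
  "total_degree f = Max (insert 0 ((\<lambda>t. \<Sum>v\<in>Poly_Mapping.keys t. Poly_Mapping.lookup t v) ` Poly_Mapping.keys f))"

definition subst_poly ::
    "('a \<Rightarrow> 'b) \<Rightarrow> ('v \<Rightarrow> 'b) \<Rightarrow> (('v \<Rightarrow>\<^sub>0 nat) \<Rightarrow>\<^sub>0 'a::zero) \<Rightarrow> 'b::comm_semiring_1" where
  \<comment> \<open>Apply \<open>h\<close> to the coefficients and replace each variable \<open>v\<close> by \<open>s v\<close>. If \<open>h\<close> is a ring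
    homomorphism, this is the unique ring homomorphism extending \<open>h\<close> and \<open>s\<close>.\<close>
  "subst_poly h s f = (\<Sum>t\<in>Poly_Mapping.keys f. h (Poly_Mapping.lookup f t) * (\<Prod>v\<in>Poly_Mapping.keys t. s v ^ Poly_Mapping.lookup t v))"

definition eval_at :: "('m::finite, 'n::finite, 'a::field) coord_ring \<Rightarrow> 'a^'n^'m \<Rightarrow> 'a" where
  "eval_at f u = subst_poly (\<lambda>c. c) (\<lambda>(i, j). u $ i $ j) f"

definition act :: "'a^'n^'n \<Rightarrow> ('m::finite, 'n::finite, 'a::field) coord_ring \<Rightarrow> ('m, 'n, 'a) coord_ring" where
  \<comment> \<open>The algebra map sending a coordinate function \<open>\<ell>\<close> to \<open>u \<mapsto> \<ell> (g\<^sup>-\<^sup>1 \<cdot> u)\<close>, where \<open>g\<close> acts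
    diagonally, i.e. on each of the \<open>m\<close> vectors.\<close>
  "act g = subst_poly Const
     (\<lambda>(i, j). \<Sum>k\<in>UNIV. Const (matrix_inv g $ j $ k) * Var (i, k))"

definition invariant_algebra ::
    "('a^'n^'n) set \<Rightarrow> ('m::finite, 'n::finite, 'a::field) coord_ring set" where
  "invariant_algebra G = {f. \<forall>g\<in>G. act g f = f}"

definition separated_by ::
    "('m::finite, 'n::finite, 'a::field) coord_ring set \<Rightarrow> 'a^'n^'m \<Rightarrow> 'a^'n^'m \<Rightarrow> bool" where
  "separated_by S u v \<longleftrightarrow> (\<exists>f\<in>S. eval_at f u \<noteq> eval_at f v)"

definition separating ::
    "('m::finite, 'n::finite, 'a::field) coord_ring set \<Rightarrow> ('m, 'n, 'a) coord_ring set \<Rightarrow> bool" where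
  "separating R S \<longleftrightarrow> S \<subseteq> R \<and> (\<forall>u v. separated_by R u v \<longrightarrow> separated_by S u v)"

definition beta_sep :: "('m::finite, 'n::finite, 'a::field) coord_ring set \<Rightarrow> nat" where
  "beta_sep R = (LEAST d. separating R {f \<in> R. total_degree f \<le> d})"

definition sigma :: "'a::field \<Rightarrow> 'a^2^2" where
  "sigma \<alpha> = vector [vector [0, \<alpha>], vector [inverse \<alpha>, 0]]"

definition tau :: "'a::field \<Rightarrow> 'a^2^2" where
  "tau \<alpha> = vector [vector [\<alpha>, 0], vector [0, inverse \<alpha>]]"

definition O2plus :: "('a::field^2^2) set" where
  "O2plus = {sigma \<alpha> | \<alpha>. \<alpha> \<noteq> 0} \<union> {tau \<alpha> | \<alpha>. \<alpha> \<noteq> 0}"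

lemma matrix_inv_eqI:
  fixes A B :: "'a::field^'n^'n"
  assumes "A ** B = mat 1" "B ** A = mat 1"
  shows "matrix_inv A = B"
proof -
  have "invertible A"
    using assms unfolding invertible_def by blast
  then have "A ** matrix_inv A = mat 1 \<and> matrix_inv A ** A = mat 1"
    unfolding invertible_def matrix_inv_def by (rule someI_ex)
  then show ?thesis
    by (metis assms(2) matrix_mul_assoc matrix_mul_lid matrix_mul_rid)
qed

lemma matrix_inv_sigma: "matrix_inv (sigma \<alpha>) = sigma \<alpha>" if "\<alpha> \<noteq> 0"
  by (rule matrix_inv_eqI)
    (use that in \<open>auto simp: sigma_def matrix_matrix_mult_def mat_def vec_eq_iff forall_2 sum_2 vector_2\<close>)

lemma matrix_inv_tau: "matrix_inv (tau \<alpha>) = tau (inverse \<alpha>)" if "\<alpha> \<noteq> 0"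
  by (rule matrix_inv_eqI)
    (use that in \<open>auto simp: tau_def matrix_matrix_mult_def mat_def vec_eq_iff forall_2 sum_2 vector_2\<close>)

lemma act_Var: "act g (Var (i, j)) = (\<Sum>k\<in>UNIV. Const (matrix_inv g $ j $ k) * Var (i, k))"
  by (simp add: act_def subst_poly_def Var_def Const_def)

lemma act_sigma_one_Var:
  "act (sigma 1) (Var (i, 1)) = Var (i, 2)" "act (sigma 1) (Var (i, 2)) = Var (i, 1)"
  by (simp_all add: act_Var matrix_inv_sigma sum_2)
    (simp_all add: sigma_def vector_2 Const_def)

lemma act_tau_Var:
  assumes "\<alpha> \<noteq> 0"
  shows "act (tau \<alpha>) (Var (i, 1)) = Const (inverse \<alpha>) * Var (i, 1)"
    and "act (tau \<alpha>) (Var (i, 2)) = Const \<alpha> * Var (i, 2)"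
  using assms by (simp_all add: act_Var matrix_inv_tau sum_2)
    (simp_all add: tau_def vector_2 Const_def)

end

theory Submission
  imports Defs
begin

text \<open>
  The invariants \<open>x\<^sub>i y\<^sub>i\<close> and \<open>x\<^sub>i y\<^sub>j + x\<^sub>j y\<^sub>i\<close> are the coefficients of the product of the linear
  forms \<open>\<Sum> x\<^sub>i t\<^sub>i\<close> and \<open>\<Sum> y\<^sub>i t\<^sub>i\<close>. If this product is nonzero, unique factorization recovers
  the two forms up to order and inverse scalars, which is exactly the orbit. If it vanishes,
  one may assume \<open>y = 0\<close>, and the invariants \<open>x\<^sub>i\<^bsup>q-2\<^esup> x\<^sub>j + y\<^sub>i\<^bsup>q-2\<^esup> y\<^sub>j\<close> determine \<open>x\<close> up to a scalar.
  So degree \<open>max 2 (q - 1)\<close> suffices. Conversely, an invariant restricted to the line spanned by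
  a vector with \<open>y = 0\<close> is constant away from the origin, hence constant if its degree is below
  \<open>q - 1\<close>; thus it does not separate such a vector from \<open>0\<close>.
\<close>

section \<open>Substitution as a ring homomorphism\<close>

definition monom_value :: "('v \<Rightarrow> 'b) \<Rightarrow> ('v \<Rightarrow>\<^sub>0 nat) \<Rightarrow> 'b::comm_monoid_mult" where
  "monom_value s t = (\<Prod>v\<in>Poly_Mapping.keys t. s v ^ Poly_Mapping.lookup t v)"

lemma monom_value_superset:
  assumes "finite A" "Poly_Mapping.keys t \<subseteq> A"
  shows "monom_value s t = (\<Prod>v\<in>A. s v ^ Poly_Mapping.lookup t v)"
  unfolding monom_value_def
  by (rule prod.mono_neutral_left) (use assms in \<open>auto simp: in_keys_iff\<close>)

lemma monom_value_zero [simp]: "monom_value s 0 = 1"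
  by (simp add: monom_value_def)

lemma monom_value_single [simp]: "monom_value s (Poly_Mapping.single v n) = s v ^ n"
  by (simp add: monom_value_def)

lemma monom_value_add: "monom_value s (t + t') = monom_value s t * monom_value s t'"
proof -
  define A where "A = Poly_Mapping.keys t \<union> Poly_Mapping.keys t'"
  have A: "finite A" "Poly_Mapping.keys t \<subseteq> A" "Poly_Mapping.keys t' \<subseteq> A"
    "Poly_Mapping.keys (t + t') \<subseteq> A"
    using Poly_Mapping.keys_add[of t t'] by (auto simp: A_def)
  show ?thesis
    by (simp add: monom_value_superset[OF A(1,2)] monom_value_superset[OF A(1,3)]
        monom_value_superset[OF A(1,4)] lookup_add power_add prod.distrib)
qed

lemma subst_poly_monom_value:
  "subst_poly h s f = (\<Sum>t\<in>Poly_Mapping.keys f. h (Poly_Mapping.lookup f t) * monom_value s t)"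
  by (simp add: subst_poly_def monom_value_def)

text \<open>The library induction updates at a fresh key, where updating is the same as adding a
  monomial. The additive form matches the linearity of \<open>subst_poly\<close>.\<close>

lemma poly_mapping_single_induct [case_names zero single_add]:
  assumes "P 0" "\<And>a b f. P f \<Longrightarrow> P (Poly_Mapping.single a b + f)"
  shows "P (f :: 'a \<Rightarrow>\<^sub>0 'b::monoid_add)"
proof (induction f rule: Poly_Mapping.update_induct)
  case (update f a b)
  have "Poly_Mapping.update a b f = Poly_Mapping.single a b + f"
    by (rule poly_mapping_eqI)
      (use update(1) in \<open>auto simp: lookup_update lookup_add lookup_single in_keys_iff\<close>)
  then show ?case using assms(2) update by simp
qed (fact assms(1))

text \<open>One notion covers the maps on coefficients, evaluation of univariate polynomials, and
  then \<open>subst_poly\<close> itself. Hence \<open>eval_at\<close> and \<open>act\<close> inherit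
  all the rules, and one substitution can be pushed inside another.\<close>

locale semiring_hom =
  fixes h :: "'a::comm_semiring_1 \<Rightarrow> 'b::comm_semiring_1"
  assumes zero: "h 0 = 0" and one: "h 1 = 1"
    and add: "h (a + b) = h a + h b" and mult: "h (a * b) = h a * h b"
begin

lemma sum: "h (\<Sum>x\<in>A. f x) = (\<Sum>x\<in>A. h (f x))"
  by (induction A rule: infinite_finite_induct) (auto simp: zero add)

lemma prod: "h (\<Prod>x\<in>A. f x) = (\<Prod>x\<in>A. h (f x))"
  by (induction A rule: infinite_finite_induct) (auto simp: one mult)

lemma power: "h (a ^ n) = h a ^ n"
  by (induction n) (auto simp: one mult)

lemma monom_value: "h (monom_value s t) = monom_value (\<lambda>v. h (s v)) t"
  by (simp add: monom_value_def prod power)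

lemma subst_poly: "h (subst_poly k s f) = subst_poly (\<lambda>c. h (k c)) (\<lambda>v. h (s v)) f"
  by (simp add: subst_poly_monom_value sum mult monom_value)

lemma subst_poly_single: "subst_poly h s (Poly_Mapping.single t c) = h c * monom_value s t"
  by (simp add: subst_poly_monom_value zero)

lemma subst_poly_add: "subst_poly h s (f + g) = subst_poly h s f + subst_poly h s g"
  unfolding subst_poly_monom_value
  by (rule setsum_keys_plus_distrib) (simp_all add: zero add distrib_right)

lemma subst_poly_single_mult:
  "subst_poly h s (Poly_Mapping.single t c * g) = h c * monom_value s t * subst_poly h s g"
proof (induction g rule: poly_mapping_single_induct)
  case zero
  then show ?case by (simp add: subst_poly_monom_value)
next
  case (single_add a b g)
  then show ?case
    by (simp add: distrib_left mult_single subst_poly_add subst_poly_single mult monom_value_add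
        mult_ac)
qed

lemma subst_poly_mult: "subst_poly h s (f * g) = subst_poly h s f * subst_poly h s g"
proof (induction f rule: poly_mapping_single_induct)
  case zero
  then show ?case by (simp add: subst_poly_monom_value)
next
  case (single_add a b f)
  then show ?case
    by (simp add: distrib_right subst_poly_add subst_poly_single_mult subst_poly_single)
qed

lemma subst_poly_Const: "subst_poly h s (Const c) = h c"
  by (simp add: Const_def subst_poly_single)

lemma subst_poly_Var: "subst_poly h s (Var v) = s v"
  by (simp add: Var_def subst_poly_single one)

lemma semiring_hom_subst_poly: "semiring_hom (subst_poly h s)"
proof
  show "subst_poly h s 0 = 0" "subst_poly h s 1 = 1"
    by (simp_all add: subst_poly_monom_value zero one)
qed (fact subst_poly_add subst_poly_mult)+

end

lemma semiring_hom_Const: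
  "semiring_hom (Const :: 'a::comm_semiring_1 \<Rightarrow> ('v \<Rightarrow>\<^sub>0 nat) \<Rightarrow>\<^sub>0 'a)"
  by unfold_locales (simp_all add: Const_def single_add mult_single)

lemma semiring_hom_id: "semiring_hom (\<lambda>c. c)"
  by unfold_locales simp_all

lemma semiring_hom_poly: "semiring_hom (\<lambda>p. poly p (a::'a::comm_semiring_1))"
  by unfold_locales simp_all

lemma semiring_hom_eval_at: "semiring_hom (\<lambda>f. eval_at f u)"
  unfolding eval_at_def by (rule semiring_hom.semiring_hom_subst_poly[OF semiring_hom_id])

lemma semiring_hom_act: "semiring_hom (act g)"
  unfolding act_def by (rule semiring_hom.semiring_hom_subst_poly[OF semiring_hom_Const])

lemmas act_hom =
  semiring_hom.add[OF semiring_hom_act] semiring_hom.mult[OF semiring_hom_act]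
  semiring_hom.power[OF semiring_hom_act]

lemma eval_at_Const [simp]: "eval_at (Const c) u = c"
  by (simp add: eval_at_def semiring_hom.subst_poly_Const[OF semiring_hom_id])

lemma eval_at_Var [simp]: "eval_at (Var (i, j)) u = u $ i $ j"
  by (simp add: eval_at_def semiring_hom.subst_poly_Var[OF semiring_hom_id])

lemma eval_at_simps [simp]:
  "eval_at (f + g) u = eval_at f u + eval_at g u"
  "eval_at (f * g) u = eval_at f u * eval_at g u"
  "eval_at (f ^ n) u = eval_at f u ^ n"
  using semiring_hom.add[OF semiring_hom_eval_at] semiring_hom.mult[OF semiring_hom_eval_at]
    semiring_hom.power[OF semiring_hom_eval_at] by blast+

text \<open>Evaluation is a homomorphism, so it passes inside the substitution that defines
  \<open>act g\<close>; each variable then becomes a coordinate of the point moved by the inverse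
  matrix.\<close>

lemma eval_at_act: "eval_at (act g f) u = eval_at f (\<chi> i. matrix_inv g *v u $ i)"
proof -
  have "eval_at (act g f) u
      = subst_poly (\<lambda>c. eval_at (Const c) u)
          (\<lambda>v. eval_at (case v of (i, j) \<Rightarrow> \<Sum>k\<in>UNIV. Const (matrix_inv g $ j $ k) * Var (i, k)) u) f"
    unfolding act_def by (rule semiring_hom.subst_poly[OF semiring_hom_eval_at])
  also have "(\<lambda>v. eval_at (case v of (i, j) \<Rightarrow> \<Sum>k\<in>UNIV. Const (matrix_inv g $ j $ k) * Var (i, k)) u)
      = (\<lambda>(i, j). (\<chi> i. matrix_inv g *v u $ i) $ i $ j)"
    by (auto simp: fun_eq_iff matrix_vector_mult_def semiring_hom.sum[OF semiring_hom_eval_at])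
  finally show ?thesis by (simp only: eval_at_Const) (simp only: eval_at_def)
qed

section \<open>Degrees\<close>

lemma total_degree_le_iff:
  "total_degree f \<le> d \<longleftrightarrow>
    (\<forall>t\<in>Poly_Mapping.keys f. (\<Sum>v\<in>Poly_Mapping.keys t. Poly_Mapping.lookup t v) \<le> d)"
  by (auto simp: total_degree_def)

lemma total_degree_Var [simp]: "total_degree (Var v :: ('v \<Rightarrow>\<^sub>0 nat) \<Rightarrow>\<^sub>0 'a::zero_neq_one) = 1"
  by (simp add: total_degree_def Var_def)

lemma total_degree_one [simp]: "total_degree (1 :: ('v \<Rightarrow>\<^sub>0 nat) \<Rightarrow>\<^sub>0 'a::zero_neq_one) = 0"
  by (simp add: total_degree_def)

lemma total_degree_add_le:
  assumes "total_degree f \<le> d" "total_degree g \<le> d"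
  shows "total_degree (f + g) \<le> d"
  using assms Poly_Mapping.keys_add[of f g] by (force simp: total_degree_le_iff)

lemma sum_lookup_add:
  fixes s t :: "'v \<Rightarrow>\<^sub>0 nat"
  shows "(\<Sum>v\<in>Poly_Mapping.keys (s + t). Poly_Mapping.lookup (s + t) v)
    = (\<Sum>v\<in>Poly_Mapping.keys s. Poly_Mapping.lookup s v) + (\<Sum>v\<in>Poly_Mapping.keys t. Poly_Mapping.lookup t v)"
  by (rule setsum_keys_plus_distrib[where f = "\<lambda>_ n. n"]) simp_all

lemma total_degree_mult_le:
  fixes f g :: "('v \<Rightarrow>\<^sub>0 nat) \<Rightarrow>\<^sub>0 'a::comm_semiring_1"
  shows "total_degree (f * g) \<le> total_degree f + total_degree g"
  unfolding total_degree_le_iff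
proof
  fix t assume "t \<in> Poly_Mapping.keys (f * g)"
  then obtain a b where "t = a + b" "a \<in> Poly_Mapping.keys f" "b \<in> Poly_Mapping.keys g"
    using Poly_Mapping.keys_mult[of f g] by auto
  then show "(\<Sum>v\<in>Poly_Mapping.keys t. Poly_Mapping.lookup t v) \<le> total_degree f + total_degree g"
    using total_degree_le_iff[of f "total_degree f"] total_degree_le_iff[of g "total_degree g"]
    by (simp add: sum_lookup_add add_mono)
qed

lemma total_degree_power_le:
  fixes f :: "('v \<Rightarrow>\<^sub>0 nat) \<Rightarrow>\<^sub>0 'a::comm_semiring_1"
  shows "total_degree (f ^ n) \<le> n * total_degree f"
proof (induction n)
  case (Suc n)
  then show ?case using total_degree_mult_le[of f "f ^ n"] by simp
qed simp

lemma degree_subst_poly_le: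
  fixes s :: "'v \<Rightarrow> 'b::comm_semiring_1 poly"
  assumes s: "\<And>v. degree (s v) \<le> 1" and h: "\<And>c. degree (h c) = 0"
  shows "degree (subst_poly h s f) \<le> total_degree f"
  unfolding subst_poly_def
proof (rule degree_sum_le)
  fix t assume t: "t \<in> Poly_Mapping.keys f"
  let ?m = "\<lambda>v. s v ^ Poly_Mapping.lookup t v"
  have "degree (h (Poly_Mapping.lookup f t) * prod ?m (Poly_Mapping.keys t)) \<le> degree (prod ?m (Poly_Mapping.keys t))"
    using degree_mult_le[of "h (Poly_Mapping.lookup f t)" "prod ?m (Poly_Mapping.keys t)"] h by simp
  also have "\<dots> \<le> (\<Sum>v\<in>Poly_Mapping.keys t. degree (?m v))"
    using degree_prod_sum_le[of "Poly_Mapping.keys t" ?m] by (simp add: o_def)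
  also have "\<dots> \<le> (\<Sum>v\<in>Poly_Mapping.keys t. Poly_Mapping.lookup t v)"
  proof (rule sum_mono)
    fix v
    have "degree (?m v) \<le> degree (s v) * Poly_Mapping.lookup t v" by (rule degree_power_le)
    also have "\<dots> \<le> Poly_Mapping.lookup t v"
      using mult_le_mono1[OF s[of v], of "Poly_Mapping.lookup t v"] by simp
    finally show "degree (?m v) \<le> Poly_Mapping.lookup t v" .
  qed
  also have "\<dots> \<le> total_degree f"
    using t total_degree_le_iff[of f "total_degree f"] by simp
  finally show "degree (h (Poly_Mapping.lookup f t) * prod ?m (Poly_Mapping.keys t)) \<le> total_degree f" .
qed simp

text \<open>Replacing every variable by a multiple of one indeterminate restricts \<open>f\<close>
  to the line through \<open>u\<close>, so that root counting in one variable applies.\<close>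

lemma eval_at_line:
  obtains p where "degree p \<le> total_degree f" "\<And>a. poly p a = eval_at f (\<chi> i. a *s (u $ i))"
proof
  let ?s = "\<lambda>(i, j). [:0, u $ i $ j:]"
  show "degree (subst_poly (\<lambda>c. [:c:]) ?s f) \<le> total_degree f"
    by (rule degree_subst_poly_le) auto
  show "poly (subst_poly (\<lambda>c. [:c:]) ?s f) a = eval_at f (\<chi> i. a *s (u $ i))" for a
    by (simp add: semiring_hom.subst_poly[OF semiring_hom_poly] eval_at_def case_prod_unfold)
qed

text \<open>The identity is checked monomial by monomial: one of degree at most 1 is either constant
  or a single variable.\<close>

lemma eval_at_affine:
  assumes "total_degree f \<le> 1"
  shows "eval_at f (u + v) + eval_at f 0 = eval_at f u + eval_at f v"
proof -
  let ?s = "\<lambda>u (i, j). u $ i $ j"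
  have "monom_value (?s (u + v)) t + monom_value (?s 0) t = monom_value (?s u) t + monom_value (?s v) t"
    if "t \<in> Poly_Mapping.keys f" for t
  proof (cases "t = 0")
    case False
    then obtain w where w: "w \<in> Poly_Mapping.keys t" by (metis ex_in_conv keys_eq_empty)
    have le: "(\<Sum>v\<in>Poly_Mapping.keys t. Poly_Mapping.lookup t v) \<le> 1"
      using that assms by (simp add: total_degree_le_iff)
    \<comment> \<open>The positive exponent at \<open>w\<close> already exhausts the degree bound 1,
      leaving nothing for other variables.\<close>
    have "Poly_Mapping.lookup t w' = (if w' = w then 1 else 0)" for w'
    proof -
      have "Poly_Mapping.lookup t w > 0" using w by (simp add: in_keys_iff)
      moreover have "Poly_Mapping.lookup t w + (\<Sum>v\<in>Poly_Mapping.keys t - {w}. Poly_Mapping.lookup t v) \<le> 1"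
        using le w by (simp add: sum.remove)
      ultimately have "Poly_Mapping.lookup t w = 1"
        "(\<Sum>v\<in>Poly_Mapping.keys t - {w}. Poly_Mapping.lookup t v) = 0" by linarith+
      then show ?thesis
        unfolding sum_eq_0_iff[OF finite_Diff[OF finite_keys]] by (metis DiffI in_keys_iff singletonD)
    qed
    then have "t = Poly_Mapping.single w 1"
      by (intro poly_mapping_eqI) (simp add: lookup_single when_def)
    then show ?thesis by (simp split: prod.split)
  qed simp
  then show ?thesis
    by (simp add: eval_at_def subst_poly_monom_value flip: sum.distrib distrib_left)
qed

section \<open>Orbits of pairs of vectors\<close>

text \<open>The supports of the two forms are disjoint, so cross relations involving
  \<open>i\<close> or \<open>k\<close> lose one term on each side; the entry at \<open>i\<close>
  then fixes the scalar.\<close>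

lemma quadratic_data_isotropic:
  fixes x y x' y' :: "'m \<Rightarrow> 'a::field"
  assumes xy: "\<And>i. x i * y i = 0" and x'y': "\<And>i. x' i * y' i = 0"
    and cross: "\<And>i j. x i * y j + x j * y i = x' i * y' j + x' j * y' i"
    and nz: "x i \<noteq> 0" "y k \<noteq> 0" and nz': "x' i * y' k \<noteq> 0"
  shows "\<exists>\<alpha>. \<alpha> \<noteq> 0 \<and> (\<forall>j. x' j = \<alpha> * x j \<and> y' j = inverse \<alpha> * y j)"
proof (intro exI conjI allI)
  have z: "y i = 0" "x k = 0" "y' i = 0" "x' k = 0"
    using xy[of i] xy[of k] x'y'[of i] x'y'[of k] nz nz' by auto
  show "x' i / x i \<noteq> 0" using nz nz' by simp
  have eq: "x i * y k = x' i * y' k" using cross[of i k] z by simp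
  fix j
  have row: "x i * y j = x' i * y' j" "x j * y k = x' j * y' k"
    using cross[of i j] cross[of j k] z by simp_all
  show "y' j = inverse (x' i / x i) * y j" using row(1) nz nz' by (simp add: field_simps)
  \<comment> \<open>The relations for \<open>(j, k)\<close> and \<open>(i, k)\<close> are multiplied
    crosswise so that the nonzero factor \<open>y' k * y k\<close> cancels.\<close>
  have "(x' j * y' k) * (x i * y k) = (x j * y k) * (x' i * y' k)" using eq row(2) by simp
  then have "(x' j * x i) * (y' k * y k) = (x' i * x j) * (y' k * y k)" by (simp only: mult_ac)
  then have "x' j * x i = x' i * x j" using nz nz' by simp
  then show "x' j = x' i / x i * x j" using nz by (simp add: eq_divide_eq)
qed

text \<open>Unique factorization made explicit. An index where both forms have nonzero coefficients
  fixes the scalar; without one, the supports are disjoint and the isotropic lemma applies, possibly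
  after a swap.\<close>

lemma quadratic_data_orbit:
  fixes x y x' y' :: "'m \<Rightarrow> 'a::field"
  assumes diag: "\<And>i. x i * y i = x' i * y' i"
    and cross: "\<And>i j. x i * y j + x j * y i = x' i * y' j + x' j * y' i"
    and nz: "\<exists>i. x i \<noteq> 0" "\<exists>k. y k \<noteq> 0"
  shows "\<exists>\<alpha>. \<alpha> \<noteq> 0 \<and> ((\<forall>j. x' j = \<alpha> * x j \<and> y' j = inverse \<alpha> * y j) \<or>
    (\<forall>j. x' j = \<alpha> * y j \<and> y' j = inverse \<alpha> * x j))"
proof (cases "\<exists>i. x i * y i \<noteq> 0")
  case True
  then obtain i where i: "x i \<noteq> 0" "y i \<noteq> 0" "x' i \<noteq> 0" "y' i \<noteq> 0" using diag by fastforce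
  \<comment> \<open>Scaling by \<open>\<alpha>\<close> is divided out, so that the pairs
    \<open>(X, Y)\<close> and \<open>(x, y)\<close> coincide at the index \<open>i\<close>.\<close>
  define \<alpha> where "\<alpha> = x' i / x i"
  define X where "X j = x' j / \<alpha>" for j
  define Y where "Y j = y' j * \<alpha>" for j
  define c where "c = y i / x i"
  have \<alpha>: "\<alpha> \<noteq> 0" and c: "c \<noteq> 0" using i by (auto simp: \<alpha>_def c_def)
  have x': "x' j = \<alpha> * X j" and y': "y' j = inverse \<alpha> * Y j" for j
    using \<alpha> by (simp_all add: X_def Y_def)
  have XY: "X j * Y j = x j * y j" for j using diag[of j] \<alpha> by (simp add: X_def Y_def)
  have CR: "X j * Y k + X k * Y j = x j * y k + x k * y j" for j k
  proof -
    have "x' j * y' k = X j * Y k" for j k using \<alpha> by (simp add: x' y')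
    then show ?thesis using cross[of j k] by simp
  qed
  have Xi: "X i = x i" using i by (simp add: X_def \<alpha>_def)
  then have Yi: "Y i = y i" using XY[of i] i by simp
  have yi: "y i = c * x i" using i by (simp add: c_def)
  \<comment> \<open>With the values at \<open>i\<close> known, the cross relation between
    \<open>i\<close> and \<open>j\<close> is linear in \<open>X j\<close> and
    \<open>Y j\<close>.\<close>
  have lin: "Y j + c * X j = y j + c * x j" for j
  proof -
    have "x i * (Y j + c * X j) = x i * (y j + c * x j)"
      using CR[of i j] by (simp add: Xi Yi yi algebra_simps)
    then show ?thesis using i by simp
  qed
  \<comment> \<open>The pairs \<open>(Y j, c * X j)\<close> and \<open>(y j, c * x j)\<close> have
    equal sum and equal product, so they agree up to order.\<close>
  have alt: "X j = x j \<and> Y j = y j \<or> c * X j = y j \<and> Y j = c * x j" for j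
  proof -
    have Y: "Y j = y j + c * x j - c * X j" using lin[of j] by (simp add: algebra_simps)
    have "(X j - x j) * (y j - c * X j) = 0"
      using XY[of j] unfolding Y by (simp add: algebra_simps)
    then show ?thesis using Y by auto
  qed
  \<comment> \<open>The order must be the same at all indices: a swap at \<open>j\<close> but not at
    \<open>k\<close> turns their cross relation into
    \<open>(y j - c * x j) * (y k - c * x k) = 0\<close> with both factors nonzero.\<close>
  consider "\<forall>j. X j = x j \<and> Y j = y j" | "\<forall>j. c * X j = y j \<and> Y j = c * x j"
  proof (rule ccontr)
    assume "\<not> thesis"
    with that obtain j k where "\<not> (X j = x j \<and> Y j = y j)" "\<not> (c * X k = y k \<and> Y k = c * x k)"
      by blast
    with alt have j: "c * X j = y j" "Y j = c * x j" "y j \<noteq> c * x j"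
      and k: "X k = x k" "Y k = y k" "y k \<noteq> c * x k"
      using c by (metis mult_cancel_left)+
    have "c * X j * Y k + X k * (c * Y j) = c * x j * y k + c * x k * y j"
      using arg_cong[OF CR[of j k], of "(*) c"] by (simp add: algebra_simps)
    then have "y j * y k + x k * (c * (c * x j)) = c * x j * y k + c * x k * y j"
      by (simp only: j(1,2) k(1,2))
    then have "(y j - c * x j) * (y k - c * x k) = 0" by (simp add: algebra_simps)
    then show False using j(3) k(3) by simp
  qed
  then show ?thesis
  proof cases
    case 1
    then show ?thesis using x' y' \<alpha> by auto
  next
    case 2
    have "x' j = \<alpha> / c * y j \<and> y' j = inverse (\<alpha> / c) * x j" for j
    proof -
      have "y j = c * X j" "Y j = c * x j" using 2 by simp_all
      then show ?thesis using c by (simp add: x' y' divide_inverse mult_ac)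
    qed
    then show ?thesis using \<alpha> c by (intro exI[of _ "\<alpha> / c"]) simp
  qed
next
  case False
  then have xy: "\<And>i. x i * y i = 0" and x'y': "\<And>i. x' i * y' i = 0" "\<And>i. y' i * x' i = 0"
    using diag by (auto simp: mult.commute)
  from nz obtain i k where ik: "x i \<noteq> 0" "y k \<noteq> 0" by blast
  then have "y i = 0" "x k = 0" using xy[of i] xy[of k] by auto
  then have "x' i * y' k + x' k * y' i \<noteq> 0" using cross[of i k] ik by (metis add_0_right mult_eq_0_iff mult_zero_left)
  \<comment> \<open>The nonvanishing term tells whether the two forms keep or exchange their
    roles.\<close>
  then consider "x' i * y' k \<noteq> 0" | "y' i * x' k \<noteq> 0" by fastforce
  then show ?thesis
  proof cases
    case 1
    from quadratic_data_isotropic[OF xy x'y'(1) cross ik 1] show ?thesis by blast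
  next
    case 2
    have "x i * y j + x j * y i = y' i * x' j + y' j * x' i" for i j
      using cross[of i j] by (simp add: mult_ac add_ac)
    from quadratic_data_isotropic[OF xy x'y'(2) this ik 2]
    obtain \<alpha> where \<alpha>: "\<alpha> \<noteq> 0" "\<forall>j. y' j = \<alpha> * x j \<and> x' j = inverse \<alpha> * y j" by blast
    then show ?thesis by (intro exI[of _ "inverse \<alpha>"]) simp
  qed
qed

section \<open>Separating invariants\<close>

lemma card_nonzero: "card (- {0 :: 'a::{zero, finite}}) = CARD('a) - 1"
  by (simp add: Compl_eq_Diff_UNIV card_Diff_singleton)

text \<open>Multiplication by \<open>a\<close> permutes the nonzero elements, so multiplying their
  nonzero product by this power of \<open>a\<close> leaves it unchanged.\<close>

lemma power_card_minus_one:
  fixes a :: "'a::{field, finite}"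
  assumes "a \<noteq> 0"
  shows "a ^ (CARD('a) - 1) = 1"
proof -
  have "bij_betw ((*) a) (- {0}) (- {0})"
    by (rule bij_betw_byWitness[where f' = "(*) (inverse a)"]) (use assms in auto)
  then have "(\<Prod>x\<in>- {0}. a * x) = \<Prod>(- {0 :: 'a})"
    by (rule prod.reindex_bij_betw[where g = "\<lambda>x. x"])
  then have "a ^ card (- {0 :: 'a}) * \<Prod>(- {0}) = \<Prod>(- {0 :: 'a})"
    by (simp add: prod.distrib)
  moreover have "\<Prod>(- {0 :: 'a}) \<noteq> 0" by simp
  ultimately show ?thesis by (simp add: card_nonzero)
qed

section \<open>Three families of invariants and their degrees\<close>

lemma act_sigma_Var:
  assumes "\<alpha> \<noteq> 0"
  shows "act (sigma \<alpha>) (Var (i, 1)) = Const \<alpha> * Var (i, 2)"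
    and "act (sigma \<alpha>) (Var (i, 2)) = Const (inverse \<alpha>) * Var (i, 1)"
  using assms by (simp_all add: act_Var matrix_inv_sigma sum_2)
    (simp_all add: sigma_def vector_2 Const_def)

lemma Const_scale_cancel:
  fixes f g :: "('v \<Rightarrow>\<^sub>0 nat) \<Rightarrow>\<^sub>0 'a::field"
  assumes "\<alpha> \<noteq> 0"
  shows "(Const \<alpha> * f) * (Const (inverse \<alpha>) * g) = f * g"
    and "(Const (inverse \<alpha>) * f) * (Const \<alpha> * g) = f * g"
proof -
  have 1: "Const \<alpha> * Const (inverse \<alpha>) = (1 :: ('v \<Rightarrow>\<^sub>0 nat) \<Rightarrow>\<^sub>0 'a)"
    using assms by (simp add: Const_def mult_single)
  have "(Const \<alpha> * f) * (Const (inverse \<alpha>) * g) = (Const \<alpha> * Const (inverse \<alpha>)) * (f * g)"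
    by (simp only: mult_ac)
  then show "(Const \<alpha> * f) * (Const (inverse \<alpha>) * g) = f * g" by (simp only: 1 mult_1)
  have "(Const (inverse \<alpha>) * f) * (Const \<alpha> * g) = (Const \<alpha> * Const (inverse \<alpha>)) * (f * g)"
    by (simp only: mult_ac)
  then show "(Const (inverse \<alpha>) * f) * (Const \<alpha> * g) = f * g" by (simp only: 1 mult_1)
qed

lemma Const_power_card:
  fixes \<alpha> :: "'a::{field, finite}" and f :: "('v \<Rightarrow>\<^sub>0 nat) \<Rightarrow>\<^sub>0 'a"
  assumes "\<alpha> \<noteq> 0"
  shows "Const \<alpha> ^ (CARD('a) - 2) * (Const \<alpha> * f) = f"
proof -
  \<comment> \<open>A field has at least two elements, so the truncated subtraction is exact and the
    exponents add up to q - 1.\<close>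
  have "CARD('a) \<ge> 2" using card_mono[of UNIV "{0, 1 :: 'a}"] by simp
  then have card: "CARD('a) - 1 = Suc (CARD('a) - 2)" by simp
  have "Const \<alpha> ^ (CARD('a) - 2) * Const \<alpha> = (Const (\<alpha> ^ (CARD('a) - 1)) :: ('v \<Rightarrow>\<^sub>0 nat) \<Rightarrow>\<^sub>0 'a)"
    unfolding card power_Suc2 semiring_hom.mult[OF semiring_hom_Const]
      semiring_hom.power[OF semiring_hom_Const] ..
  also have "\<dots> = 1"
    unfolding power_card_minus_one[OF assms] Const_def by (rule single_one)
  finally show ?thesis by (simp only: mult.assoc[symmetric] mult_1)
qed

text \<open>Kept apart from \<open>cross_inv\<close>, since \<open>cross_inv i i\<close> is twice
  \<open>diag_inv i\<close> and vanishes in characteristic 2.\<close>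

definition diag_inv :: "'m::finite \<Rightarrow> ('m, 2, 'a::field) coord_ring" where
  "diag_inv i = Var (i, 1) * Var (i, 2)"

definition cross_inv :: "'m::finite \<Rightarrow> 'm \<Rightarrow> ('m, 2, 'a::field) coord_ring" where
  "cross_inv i j = Var (i, 1) * Var (j, 2) + Var (j, 1) * Var (i, 2)"

text \<open>For q = 2 the exponent is 0, and this is the linear invariant
  \<open>Var (j, 1) + Var (j, 2)\<close>.\<close>

definition power_inv :: "'m::finite \<Rightarrow> 'm \<Rightarrow> ('m, 2, 'a::{field, finite}) coord_ring" where
  "power_inv i j = Var (i, 1) ^ (CARD('a) - 2) * Var (j, 1) + Var (i, 2) ^ (CARD('a) - 2) * Var (j, 2)"

lemma invariant_algebra_O2plus_iff:
  "f \<in> invariant_algebra O2plus \<longleftrightarrow> (\<forall>\<alpha>. \<alpha> \<noteq> 0 \<longrightarrow> act (sigma \<alpha>) f = f \<and> act (tau \<alpha>) f = f)"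
  by (auto simp: invariant_algebra_def O2plus_def)

lemma diag_inv_invariant: "diag_inv i \<in> invariant_algebra O2plus"
  by (simp add: invariant_algebra_O2plus_iff diag_inv_def act_hom act_sigma_Var act_tau_Var
      Const_scale_cancel mult.commute)

lemma cross_inv_invariant: "cross_inv i j \<in> invariant_algebra O2plus"
  by (simp add: invariant_algebra_O2plus_iff cross_inv_def act_hom act_sigma_Var act_tau_Var
      Const_scale_cancel mult.commute add.commute)

lemma power_inv_invariant:
  "(power_inv i j :: ('m::finite, 2, 'a::{field, finite}) coord_ring) \<in> invariant_algebra O2plus"
proof -
  have C: "(Const \<alpha> * f) ^ (CARD('a) - 2) * (Const \<alpha> * g) = f ^ (CARD('a) - 2) * g"
    if "\<alpha> \<noteq> 0" for \<alpha> :: 'a and f g :: "('m, 2, 'a) coord_ring"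
  proof -
    have "(Const \<alpha> * f) ^ (CARD('a) - 2) * (Const \<alpha> * g)
        = Const \<alpha> ^ (CARD('a) - 2) * (Const \<alpha> * (f ^ (CARD('a) - 2) * g))"
      by (simp only: power_mult_distrib mult_ac)
    also have "\<dots> = f ^ (CARD('a) - 2) * g" by (rule Const_power_card[OF that])
    finally show ?thesis .
  qed
  show ?thesis
    by (simp add: invariant_algebra_O2plus_iff power_inv_def act_hom act_sigma_Var act_tau_Var C add_ac)
qed

lemma total_degree_diag_inv: "total_degree (diag_inv i) \<le> 2"
  unfolding diag_inv_def by (rule order_trans[OF total_degree_mult_le]) simp

lemma total_degree_cross_inv: "total_degree (cross_inv i j) \<le> 2"
  unfolding cross_inv_def
  by (intro total_degree_add_le order_trans[OF total_degree_mult_le]) simp_all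

lemma total_degree_power_inv:
  "total_degree (power_inv i j :: ('m::finite, 2, 'a::{field, finite}) coord_ring) \<le> CARD('a) - 1"
proof -
  have "CARD('a) \<ge> 2" using card_mono[of UNIV "{0, 1 :: 'a}"] by simp
  then have card: "CARD('a) - 2 + 1 = CARD('a) - 1" by linarith
  have "total_degree (Var v ^ (CARD('a) - 2) * Var w :: ('m, 2, 'a) coord_ring) \<le> CARD('a) - 1" for v w
    unfolding card[symmetric]
    by (rule order_trans[OF total_degree_mult_le add_mono[OF order_trans[OF total_degree_power_le]]])
      (simp_all only: total_degree_Var mult_1_right order_refl)
  then show ?thesis unfolding power_inv_def by (intro total_degree_add_le)
qed

section \<open>Upper bound: the three families determine all invariants\<close>

lemma eval_at_invariant:
  assumes "f \<in> invariant_algebra O2plus" "\<alpha> \<noteq> 0"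
  shows "eval_at f (\<chi> i. tau \<alpha> *v u $ i) = eval_at f u"
    and "eval_at f (\<chi> i. sigma \<alpha> *v u $ i) = eval_at f u"
  \<comment> \<open>\<open>eval_at_act\<close> moves the point by the inverse matrix, hence the
    inverse scalar for \<open>tau\<close>; \<open>sigma \<alpha>\<close> is its own inverse.\<close>
  using assms eval_at_act[of "tau (inverse \<alpha>)" f u] eval_at_act[of "sigma \<alpha>" f u]
  by (simp_all add: invariant_algebra_O2plus_iff matrix_inv_tau matrix_inv_sigma)

lemma eval_at_invariant_tau:
  assumes "f \<in> invariant_algebra O2plus" "\<alpha> \<noteq> 0"
    and "\<And>i. v $ i $ 1 = \<alpha> * u $ i $ 1" "\<And>i. v $ i $ 2 = inverse \<alpha> * u $ i $ 2"
  shows "eval_at f v = eval_at f u"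
proof -
  have "v = (\<chi> i. tau \<alpha> *v u $ i)"
    using assms(3,4) by (simp add: vec_eq_iff forall_2 matrix_vector_mult_def sum_2 tau_def)
  then show ?thesis using eval_at_invariant(1)[OF assms(1,2)] by simp
qed

lemma eval_at_invariant_sigma:
  assumes "f \<in> invariant_algebra O2plus" "\<alpha> \<noteq> 0"
    and "\<And>i. v $ i $ 1 = \<alpha> * u $ i $ 2" "\<And>i. v $ i $ 2 = inverse \<alpha> * u $ i $ 1"
  shows "eval_at f v = eval_at f u"
proof -
  have "v = (\<chi> i. sigma \<alpha> *v u $ i)"
    using assms(3,4) by (simp add: vec_eq_iff forall_2 matrix_vector_mult_def sum_2 sigma_def)
  then show ?thesis using eval_at_invariant(2)[OF assms(1,2)] by simp
qed

lemma power_data_scalar: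
  fixes x x' :: "'m \<Rightarrow> 'a::{field, finite}"
  assumes eq: "\<And>i j. x i ^ (CARD('a) - 2) * x j = x' i ^ (CARD('a) - 2) * x' j"
  shows "\<exists>\<alpha>. \<alpha> \<noteq> 0 \<and> (\<forall>j. x' j = \<alpha> * x j)"
proof (cases "\<exists>i. x i \<noteq> 0")
  case True
  then obtain i where i: "x i \<noteq> 0" by blast
  define n where "n = CARD('a) - 2"
  have "x i ^ n \<noteq> 0" using i by simp
  moreover have x': "x' i ^ n \<noteq> 0"
    using eq[of i i] i by (auto simp flip: n_def)
  ultimately have "x i ^ n / x' i ^ n \<noteq> 0" by simp
  moreover have "x' j = x i ^ n / x' i ^ n * x j" for j
    using eq[of i j] x' unfolding n_def[symmetric]
    by (simp add: eq_divide_eq mult.commute)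
  ultimately show ?thesis by blast
next
  case False
  then have "x' j ^ (CARD('a) - 2) * x' j = 0" for j using eq[of j j] by simp
  then have "x' j = 0" for j by (metis mult_eq_0_iff power_not_zero)
  then show ?thesis using False by (intro exI[of _ 1]) simp
qed

lemma invariants_determined:
  fixes u v :: "'a::{field, finite}^2^'m::finite"
  assumes diag: "\<And>i. eval_at (diag_inv i) u = eval_at (diag_inv i) v"
    and cross: "\<And>i j. eval_at (cross_inv i j) u = eval_at (cross_inv i j) v"
    and power: "\<And>i j. eval_at (power_inv i j) u = eval_at (power_inv i j) v"
    and f: "f \<in> invariant_algebra O2plus"
  shows "eval_at f u = eval_at f v"
proof -
  have d: "u $ i $ 1 * u $ i $ 2 = v $ i $ 1 * v $ i $ 2" for i
    using diag[of i] by (simp add: diag_inv_def)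
  have c: "u $ i $ 1 * u $ j $ 2 + u $ j $ 1 * u $ i $ 2 = v $ i $ 1 * v $ j $ 2 + v $ j $ 1 * v $ i $ 2" for i j
    using cross[of i j] by (simp add: cross_inv_def)
  have p: "u $ i $ 1 ^ (CARD('a) - 2) * u $ j $ 1 + u $ i $ 2 ^ (CARD('a) - 2) * u $ j $ 2
      = v $ i $ 1 ^ (CARD('a) - 2) * v $ j $ 1 + v $ i $ 2 ^ (CARD('a) - 2) * v $ j $ 2" for i j
    using power[of i j] by (simp add: power_inv_def)
  \<comment> \<open>\<open>iso w\<close> says that the product of the two linear forms attached to
    \<open>w\<close> vanishes.\<close>
  define iso where "iso w \<longleftrightarrow> (\<forall>i. w $ i $ 1 = 0) \<or> (\<forall>i. w $ i $ 2 = 0)" for w :: "'a^2^'m"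
  have orbit: ?thesis if "\<not> iso u"
    using quadratic_data_orbit[of "\<lambda>i. u $ i $ 1" "\<lambda>i. u $ i $ 2" "\<lambda>i. v $ i $ 1" "\<lambda>i. v $ i $ 2", OF d c]
      that eval_at_invariant_tau[OF f, of _ v u] eval_at_invariant_sigma[OF f, of _ v u]
    unfolding iso_def by metis
  \<comment> \<open>Exchanging \<open>u\<close> and \<open>v\<close> also settles the case where
    only \<open>v\<close> is not isotropic, leaving two isotropic points.\<close>
  have orbit': ?thesis if "\<not> iso v"
    using quadratic_data_orbit[of "\<lambda>i. v $ i $ 1" "\<lambda>i. v $ i $ 2" "\<lambda>i. u $ i $ 1" "\<lambda>i. u $ i $ 2",
        OF d[symmetric] c[symmetric]]
      that eval_at_invariant_tau[OF f, of _ u v] eval_at_invariant_sigma[OF f, of _ u v]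
    unfolding iso_def by metis
  \<comment> \<open>For isotropic \<open>w\<close> one row is zero, so the sum of the rows is the
    other one: \<open>s w\<close> is \<open>w\<close> or its image under \<open>sigma 1\<close>,
    normalised to have second row zero.\<close>
  define s :: "'a^2^'m \<Rightarrow> 'a^2^'m" where "s w = (\<chi> i. vector [w $ i $ 1 + w $ i $ 2, 0])" for w :: "'a^2^'m"
  have s: "s w $ i $ 1 = w $ i $ 1 + w $ i $ 2" "s w $ i $ 2 = 0" for w i
    by (simp_all add: s_def)
  have eval_s: "eval_at f (s w) = eval_at f w" if "iso w" for w
    using that eval_at_invariant_tau[OF f, of 1 "s w" w] eval_at_invariant_sigma[OF f, of 1 "s w" w]
    unfolding iso_def by (auto simp: s)
  have p_s: "s w $ i $ 1 ^ (CARD('a) - 2) * s w $ j $ 1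
      = w $ i $ 1 ^ (CARD('a) - 2) * w $ j $ 1 + w $ i $ 2 ^ (CARD('a) - 2) * w $ j $ 2"
    if "iso w" for w i j
    using that unfolding iso_def by (auto simp: s)
  show ?thesis
  proof (cases "iso u \<and> iso v")
    case True
    then obtain \<alpha> where \<alpha>: "\<alpha> \<noteq> 0" "\<And>j. s v $ j $ 1 = \<alpha> * s u $ j $ 1"
      using power_data_scalar[of "\<lambda>i. s u $ i $ 1" "\<lambda>i. s v $ i $ 1"] p by (auto simp: p_s)
    have "eval_at f (s v) = eval_at f (s u)"
      by (rule eval_at_invariant_tau[OF f \<alpha>]) (simp add: s)
    then show ?thesis using True by (simp add: eval_s)
  next
    case False
    then show ?thesis using orbit orbit' by blast
  qed
qed

lemma separating_low_degree:
  assumes "CARD('a::{field, finite}) - 1 \<le> d" "2 \<le> d"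
  shows "separating (invariant_algebra O2plus)
    {f \<in> invariant_algebra O2plus :: ('m::finite, 2, 'a) coord_ring set. total_degree f \<le> d}"
    (is "separating ?R ?S")
proof -
  have mem: "diag_inv i \<in> ?S" "cross_inv i j \<in> ?S" "power_inv i j \<in> ?S" for i j
    using assms total_degree_diag_inv[of i] total_degree_cross_inv[of i j] total_degree_power_inv[of i j]
    by (auto simp: diag_inv_invariant cross_inv_invariant power_inv_invariant intro: order_trans)
  have "eval_at f u = eval_at f v" if "f \<in> ?R" "\<not> separated_by ?S u v" for f u v
  proof (rule invariants_determined[OF _ _ _ that(1)])
    have "eval_at g u = eval_at g v" if "g \<in> ?S" for g
      using that \<open>\<not> separated_by ?S u v\<close> unfolding separated_by_def by blast
    then show "eval_at (diag_inv i) u = eval_at (diag_inv i) v"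
      "eval_at (cross_inv i j) u = eval_at (cross_inv i j) v"
      "eval_at (power_inv i j) u = eval_at (power_inv i j) v" for i j
      using mem by blast+
  qed
  then show ?thesis unfolding separating_def separated_by_def[of ?R] by blast
qed

section \<open>Lower bounds\<close>

lemma eval_at_axis_low_degree:
  fixes f :: "('m::finite, 2, 'a::{field, finite}) coord_ring"
  assumes f: "f \<in> invariant_algebra O2plus" and deg: "total_degree f < CARD('a) - 1"
  shows "eval_at f (axis i (axis 1 1)) = eval_at f 0"
proof -
  let ?u = "axis i (axis 1 1) :: 'a^2^'m"
  obtain p where p: "degree p \<le> total_degree f" "\<And>a. poly p a = eval_at f (\<chi> i. a *s (?u $ i))"
    by (rule eval_at_line[of f ?u]) blast
  \<comment> \<open>The second coordinates are zero, so scaling by \<open>a\<close> is the same as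
    acting by \<open>tau a\<close>.\<close>
  have val: "poly p a = eval_at f ?u" if "a \<noteq> 0" for a
    unfolding p(2) by (rule eval_at_invariant_tau[OF f that]) (auto simp: axis_def)
  \<comment> \<open>Two polynomials of degree below q - 1 agree at the q - 1 nonzero scalars;
    equality then carries the value over to 0.\<close>
  have "p = [:eval_at f ?u:]"
  proof (rule poly_eqI_degree[where A = "- {0}"])
    show "degree p < card (- {0 :: 'a})" "degree [:eval_at f ?u:] < card (- {0 :: 'a})"
      using p(1) deg by (simp_all add: card_nonzero)
  qed (simp add: val)
  moreover have "poly p 0 = eval_at f 0"
  proof -
    have "(\<chi> i. 0 *s (?u $ i)) = 0" by (simp add: vec_eq_iff)
    then show ?thesis by (simp add: p(2))
  qed
  ultimately show ?thesis by simp
qed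

lemma not_separating_low_degree:
  assumes "d < CARD('a::{field, finite}) - 1"
  shows "\<not> separating (invariant_algebra O2plus)
    {f \<in> invariant_algebra O2plus :: ('m::finite, 2, 'a) coord_ring set. total_degree f \<le> d}"
    (is "\<not> separating ?R ?S")
proof
  assume "separating ?R ?S"
  define i :: 'm where "i = undefined"
  let ?u = "axis i (axis 1 1) :: 'a^2^'m"
  \<comment> \<open>The values are 1 and 0, also for q = 2.\<close>
  have "eval_at (power_inv i i) ?u \<noteq> eval_at (power_inv i i) 0"
    by (simp add: power_inv_def axis_def)
  then have "separated_by ?R ?u 0"
    using power_inv_invariant[of i i] unfolding separated_by_def by blast
  then have "separated_by ?S ?u 0"
    using \<open>separating ?R ?S\<close> unfolding separating_def by blast
  moreover have "eval_at f ?u = eval_at f 0" if "f \<in> ?S" for f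
    using that assms by (intro eval_at_axis_low_degree) auto
  ultimately show False unfolding separated_by_def by blast
qed

lemma add_self_card_2:
  fixes a :: "'a::{field, finite}"
  assumes "CARD('a) = 2"
  shows "a + a = 0"
proof -
  \<comment> \<open>For q = 2 the exponent q - 1 is 1, so the power identity for -1 reads
    \<open>- 1 = 1\<close>.\<close>
  have "- 1 = (1 :: 'a)"
    using power_card_minus_one[of "- 1 :: 'a"] assms by simp
  then have "a * 1 + a * 1 = a * 1 + a * (- 1)" by simp
  then show ?thesis by simp
qed

text \<open>Over the field with two elements, \<open>(1, 1)\<close> and \<open>(0, 0)\<close> are separated by \<open>x\<^sub>i y\<^sub>i\<close>, but an affine
  invariant has \<open>f (1, 1) + f (0, 0) = f (1, 0) + f (0, 1) = 2 f (1, 0) = 0\<close>.\<close>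

lemma not_separating_affine_card_2:
  assumes card: "CARD('a::{field, finite}) = 2" and "d < 2"
  shows "\<not> separating (invariant_algebra O2plus)
    {f \<in> invariant_algebra O2plus :: ('m::finite, 2, 'a) coord_ring set. total_degree f \<le> d}"
    (is "\<not> separating ?R ?S")
proof
  assume "separating ?R ?S"
  define i :: 'm where "i = undefined"
  let ?u = "axis i (axis 1 1) :: 'a^2^'m" and ?v = "axis i (axis 2 1) :: 'a^2^'m"
  have "eval_at (diag_inv i) (?u + ?v) \<noteq> eval_at (diag_inv i) 0"
    by (simp add: diag_inv_def axis_def)
  then have "separated_by ?R (?u + ?v) 0"
    using diag_inv_invariant[of i] unfolding separated_by_def by blast
  then have "separated_by ?S (?u + ?v) 0"
    using \<open>separating ?R ?S\<close> unfolding separating_def by blast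
  moreover have "eval_at f (?u + ?v) = eval_at f 0" if "f \<in> ?S" for f
  proof -
    have "eval_at f ?v = eval_at f ?u"
      by (rule eval_at_invariant_sigma[where \<alpha> = 1]) (use that in \<open>auto simp: axis_def\<close>)
    moreover have "eval_at f (?u + ?v) + eval_at f 0 = eval_at f ?u + eval_at f ?v"
      by (rule eval_at_affine) (use that \<open>d < 2\<close> in auto)
    \<comment> \<open>Every doubled value is 0, so the sum can be written as twice
      \<open>eval_at f 0\<close>, ready for cancellation.\<close>
    ultimately have "eval_at f (?u + ?v) + eval_at f 0 = eval_at f 0 + eval_at f 0"
      by (simp add: add_self_card_2[OF card])
    then show ?thesis by simp
  qed
  ultimately show False unfolding separated_by_def by blast
qed

theorem corollary4p4:
  fixes q :: nat
  assumes "q = CARD('a::{field, finite})"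
  shows "(q = 2 \<longrightarrow> beta_sep (invariant_algebra O2plus :: ('m::finite, 2, 'a) coord_ring set) = 2) \<and>
         (q > 2 \<longrightarrow> beta_sep (invariant_algebra O2plus :: ('m, 2, 'a) coord_ring set) = q - 1)"
proof (intro conjI impI)
  \<comment> \<open>Here \<open>power_inv\<close> needs only degree 1, so the quadratic invariants
    set the bound and the affine obstruction gives minimality.\<close>
  assume "q = 2"
  then show "beta_sep (invariant_algebra O2plus :: ('m, 2, 'a) coord_ring set) = 2"
    unfolding beta_sep_def
    using assms not_separating_affine_card_2[where 'a = 'a and 'm = 'm]
    by (intro Least_equality separating_low_degree) (auto intro: leI)
next
  \<comment> \<open>Now q - 1 is at least 2, so the quadratic invariants fit below the bound set by
    \<open>power_inv\<close>.\<close>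
  assume "q > 2"
  then show "beta_sep (invariant_algebra O2plus :: ('m, 2, 'a) coord_ring set) = q - 1"
    unfolding beta_sep_def
    using assms not_separating_low_degree[where 'a = 'a and 'm = 'm]
    by (intro Least_equality separating_low_degree) (auto intro: leI)
qed

end
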